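(* Let $D=\mathbb{Z}[\omega]$ with $\omega=\frac{-1+i\sqrt{3}}{2}$, and let $\pi\in D$ be a prime. Then the residue class ring $D/\pi D$ is a finite field with $N\pi$ elements.
   Context: For $\alpha=a+b\omega\in D$ with $a,b\in\mathbb{Z}$, the norm is $N\alpha=\alpha\overline{\alpha}=a^2-ab+b^2$. *)

theory Defs
  imports Complex_Main "HOL-Algebra.Ring_Divisibility" "HOL-Algebra.QuotRing"
begin

definition eis_omega :: complex (\<open>\<omega>\<close>)
  where "\<omega> = (- 1 + \<i> * complex_of_real (sqrt 3)) / 2"

definition eis_ring :: "complex ring"
  where "eis_ring = \<lparr>carrier = {of_int a + of_int b * \<omega> | a b :: int. True},
    mult = (*), one = 1, zero = 0, add = (+)\<rparr>"

text \<open>The norm is kept complex-valued, as the product of \<open>\<alpha>\<close> with its conjugate; its integrality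
  on \<open>\<int>[\<omega>]\<close> is the content of \<open>eis_norm_eq\<close>.\<close>

definition eis_norm :: "complex \<Rightarrow> complex"
  where "eis_norm \<alpha> = \<alpha> * cnj \<alpha>"

lemma eis_norm_eq: "eis_norm (of_int a + of_int b * \<omega>) = of_int (a\<^sup>2 - a * b + b\<^sup>2)"
  by (simp add: eis_norm_def eis_omega_def complex_eq_iff power2_eq_square field_simps)

lemma eis_omega_square: "\<omega> * \<omega> = - 1 - \<omega>"
  by (simp add: eis_omega_def complex_eq_iff field_simps)

lemma eis_ring_memI: "x = of_int a + of_int b * \<omega> \<Longrightarrow> x \<in> carrier eis_ring"
  by (auto simp: eis_ring_def)

lemma eis_ring_domain: "domain eis_ring"
proof -
  have "cring eis_ring"
  proof (rule cringI)
    show "abelian_group eis_ring"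
    proof (rule abelian_groupI)
      fix x y assume "x \<in> carrier eis_ring" "y \<in> carrier eis_ring"
      then obtain a b c d :: int
        where "x = of_int a + of_int b * \<omega>" "y = of_int c + of_int d * \<omega>"
        by (auto simp: eis_ring_def)
      then have "x \<oplus>\<^bsub>eis_ring\<^esub> y = of_int (a + c) + of_int (b + d) * \<omega>"
        by (simp add: eis_ring_def algebra_simps)
      then show "x \<oplus>\<^bsub>eis_ring\<^esub> y \<in> carrier eis_ring"
        by (rule eis_ring_memI)
    next
      have "\<zero>\<^bsub>eis_ring\<^esub> = of_int 0 + of_int 0 * \<omega>"
        by (simp add: eis_ring_def)
      then show "\<zero>\<^bsub>eis_ring\<^esub> \<in> carrier eis_ring"
        by (rule eis_ring_memI)
    next
      fix x assume "x \<in> carrier eis_ring"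
      then obtain a b :: int where x: "x = of_int a + of_int b * \<omega>"
        by (auto simp: eis_ring_def)
      have "of_int (- a) + of_int (- b) * \<omega> \<in> carrier eis_ring"
        by (rule eis_ring_memI) (rule refl)
      moreover have "(of_int (- a) + of_int (- b) * \<omega>) \<oplus>\<^bsub>eis_ring\<^esub> x = \<zero>\<^bsub>eis_ring\<^esub>"
        by (simp add: x eis_ring_def)
      ultimately show "\<exists>y\<in>carrier eis_ring. y \<oplus>\<^bsub>eis_ring\<^esub> x = \<zero>\<^bsub>eis_ring\<^esub>"
        by blast
    qed (simp_all add: eis_ring_def add_ac)
    show "comm_monoid eis_ring"
    proof (rule comm_monoidI)
      fix x y assume "x \<in> carrier eis_ring" "y \<in> carrier eis_ring"
      then obtain a b c d :: int
        where "x = of_int a + of_int b * \<omega>" "y = of_int c + of_int d * \<omega>"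
        by (auto simp: eis_ring_def)
      then have "x * y = of_int (a * c) + of_int (a * d + b * c) * \<omega> + of_int (b * d) * (\<omega> * \<omega>)"
        by (simp add: algebra_simps)
      also have "\<dots> = of_int (a * c - b * d) + of_int (a * d + b * c - b * d) * \<omega>"
        unfolding eis_omega_square by (simp add: algebra_simps)
      finally have "x \<otimes>\<^bsub>eis_ring\<^esub> y = of_int (a * c - b * d) + of_int (a * d + b * c - b * d) * \<omega>"
        by (simp add: eis_ring_def)
      then show "x \<otimes>\<^bsub>eis_ring\<^esub> y \<in> carrier eis_ring"
        by (rule eis_ring_memI)
    next
      have "\<one>\<^bsub>eis_ring\<^esub> = of_int 1 + of_int 0 * \<omega>"
        by (simp add: eis_ring_def)
      then show "\<one>\<^bsub>eis_ring\<^esub> \<in> carrier eis_ring"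
        by (rule eis_ring_memI)
    qed (simp_all add: eis_ring_def mult_ac)
  qed (simp add: eis_ring_def distrib_right)
  then show ?thesis
    by (rule domain.intro) (unfold_locales, simp_all add: eis_ring_def)
qed

end

theory Submission
  imports Defs
begin

text \<open>The index of \<open>\<alpha>D\<close> in \<open>D\<close> is \<open>N\<alpha>\<close> for every nonzero \<open>\<alpha> = g (a + b\<omega>)\<close> with \<open>a, b\<close>
  coprime. If \<open>a u + b v = 1\<close>, then \<open>p = a y - b x\<close> and \<open>q = u x + v y\<close> are unimodular coordinates
  of \<open>x + y\<omega>\<close>, and they put the lattice \<open>\<alpha>D\<close> in diagonal form: it is given by
  \<open>g (a\<^sup>2 - a b + b\<^sup>2)\<close> dividing \<open>p\<close> and \<open>g\<close> dividing \<open>q\<close>. If \<open>\<alpha>\<close> is prime, the quotient is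
  a finite integral domain, hence a field.\<close>

text \<open>Since \<open>\<omega>\<close> has nonzero imaginary part, imaginary parts determine the
  second coefficient, and then the first.\<close>

lemma eis_coeffs_unique:
  assumes "of_int x + of_int y * \<omega> = of_int x' + of_int y' * \<omega>"
  shows "x = x'" "y = y'"
proof -
  show "y = y'"
    using arg_cong[OF assms, of Im] by (simp add: eis_omega_def)
  with assms show "x = x'"
    by simp
qed

lemma eis_mult:
  "(of_int a + of_int b * \<omega>) * (of_int s + of_int t * \<omega>)
    = of_int (a * s - b * t) + of_int (a * t + b * s - b * t) * \<omega>"
proof -
  have "(of_int a + of_int b * \<omega>) * (of_int s + of_int t * \<omega>)
      = of_int (a * s) + of_int (a * t + b * s) * \<omega> + of_int (b * t) * (\<omega> * \<omega>)"
    by (simp add: algebra_simps)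
  also have "\<dots> = of_int (a * s - b * t) + of_int (a * t + b * s - b * t) * \<omega>"
    unfolding eis_omega_square by (simp add: algebra_simps)
  finally show ?thesis .
qed

text \<open>The left side says that x + y\<omega> is g (a + b\<omega>)(s + t\<omega>). Eliminating s
  from the two equations leaves a condition on t alone, with the norm of a + b\<omega> as
  coefficient. The other coordinate then only has to be a multiple of g, because s occurs in it with
  coefficient g.\<close>

lemma eis_lattice_iff:
  fixes a b g u v x y :: int
  assumes bezout: "a * u + b * v = 1"
  shows "(\<exists>s t. x = g * (a * s - b * t) \<and> y = g * (a * t + b * s - b * t)) \<longleftrightarrow>
    g * (a\<^sup>2 - a * b + b\<^sup>2) dvd a * y - b * x \<and> g dvd u * x + v * y"
    (is "?L \<longleftrightarrow> ?R")
proof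
  assume ?L
  then obtain s t where xy: "x = g * (a * s - b * t)" "y = g * (a * t + b * s - b * t)"
    by blast
  have "a * y - b * x = g * (a\<^sup>2 - a * b + b\<^sup>2) * t"
    unfolding xy by (simp add: algebra_simps power2_eq_square)
  moreover have "g dvd u * x + v * y"
    unfolding xy by simp
  ultimately show ?R by simp
next
  assume ?R
  then obtain t k where p: "a * y - b * x = g * (a\<^sup>2 - a * b + b\<^sup>2) * t"
    and q: "u * x + v * y = g * k"
    by (auto elim!: dvdE)
  \<comment> \<open>For x, y of the desired form, Bezout gives u x + v y = g (s - t (b u - v a + v
    b)). Equating this with g k dictates s.\<close>
  define s where "s = k + t * (b * u - v * a + v * b)"
  have "x = (a * u + b * v) * x" "y = (a * u + b * v) * y"
    by (simp_all add: bezout)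
  then have x: "x = a * (u * x + v * y) - v * (a * y - b * x)"
    and y: "y = b * (u * x + v * y) + u * (a * y - b * x)"
    by (simp_all add: algebra_simps)
  \<comment> \<open>Polynomial identities valid for all integers: the last summand isolates the
    Bezout defect a u + b v - 1, which then vanishes.\<close>
  have "a * s - b * t = a * k - v * (a\<^sup>2 - a * b + b\<^sup>2) * t + t * b * (a * u + b * v - 1)"
    "a * t + b * s - b * t = b * k + u * (a\<^sup>2 - a * b + b\<^sup>2) * t - t * (a - b) * (a * u + b * v - 1)"
    unfolding s_def by (simp_all add: algebra_simps power2_eq_square)
  then have st: "a * s - b * t = a * k - v * (a\<^sup>2 - a * b + b\<^sup>2) * t"
    "a * t + b * s - b * t = b * k + u * (a\<^sup>2 - a * b + b\<^sup>2) * t"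
    by (simp_all add: bezout)
  have "x = g * (a * s - b * t)"
    unfolding st using x unfolding p q by (simp add: algebra_simps)
  moreover have "y = g * (a * t + b * s - b * t)"
    unfolding st using y unfolding p q by (simp add: algebra_simps)
  ultimately show ?L by blast
qed

text \<open>Maps with equal fibres have ranges in bijection: pick an \<open>f\<close>-preimage and
  apply \<open>h\<close>. This lets cosets be counted through pairs of residues.\<close>

lemma card_range_eq:
  assumes "\<And>z w. h z = h w \<longleftrightarrow> f z = f w"
  shows "finite (range h) \<longleftrightarrow> finite (range f)" "card (range h) = card (range f)"
proof -
  have "bij_betw (\<lambda>c. h (inv_into UNIV f c)) (range f) (range h)"
    unfolding bij_betw_def
  proof
    show "inj_on (\<lambda>c. h (inv_into UNIV f c)) (range f)"
      by (auto simp: inj_on_def assms f_inv_into_f)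
    have "h (inv_into UNIV f (f z)) = h z" for z
      by (simp add: assms f_inv_into_f)
    then show "(\<lambda>c. h (inv_into UNIV f c)) ` range f = range h"
      by (simp add: image_image)
  qed
  then show "finite (range h) \<longleftrightarrow> finite (range f)" "card (range h) = card (range f)"
    by (auto dest: bij_betw_finite bij_betw_same_card)
qed

lemma range_mod_unimodular:
  fixes a b u v m n :: int
  assumes bezout: "a * u + b * v = 1" and "m > 0" "n > 0"
  shows "range (\<lambda>(x, y). ((a * y - b * x) mod m, (u * x + v * y) mod n)) = {0..<m} \<times> {0..<n}"
    (is "range ?f = _")
proof
  show "range ?f \<subseteq> {0..<m} \<times> {0..<n}"
    using assms(2,3) by auto
  show "{0..<m} \<times> {0..<n} \<subseteq> range ?f"
  proof clarify
    fix p q assume pq: "p \<in> {0..<m}" "q \<in> {0..<n}"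
    \<comment> \<open>The preimage (a q - v p, b q + u p) comes from inverting the coordinate
      change, whose determinant is -(a u + b v) = -1.\<close>
    have "a * (b * q + u * p) - b * (a * q - v * p) = (a * u + b * v) * p"
      "u * (a * q - v * p) + v * (b * q + u * p) = (a * u + b * v) * q"
      by (simp_all add: algebra_simps)
    then have "?f (a * q - v * p, b * q + u * p) = (p, q)"
      using pq by (simp add: bezout)
    then show "(p, q) \<in> range ?f"
      by (rule range_eqI[OF sym])
  qed
qed

lemma (in cring) cgenideal_rcos_eq_iff:
  assumes "a \<in> carrier R" "x \<in> carrier R" "y \<in> carrier R"
  shows "PIdl a +> x = PIdl a +> y \<longleftrightarrow> (\<exists>r\<in>carrier R. x \<ominus> y = r \<otimes> a)"
  using quotient_eq_iff_same_a_r_cos[OF cgenideal_ideal[OF assms(1)] assms(2,3)]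
  by (auto simp: cgenideal_def)

text \<open>Subtraction in \<open>eis_ring\<close> goes through an abstract additive inverse, so it
  is identified by adding y back.\<close>

lemma eis_a_minus:
  assumes "x \<in> carrier eis_ring" "y \<in> carrier eis_ring"
  shows "x \<ominus>\<^bsub>eis_ring\<^esub> y = x - y"
proof -
  interpret domain eis_ring by (rule eis_ring_domain)
  have "x \<ominus>\<^bsub>eis_ring\<^esub> y \<oplus>\<^bsub>eis_ring\<^esub> y = x"
    using assms by algebra
  then show ?thesis
    by (simp add: eis_ring_def eq_diff_eq)
qed

lemma eis_quot_card:
  assumes "\<alpha> \<in> carrier eis_ring" "\<alpha> \<noteq> 0"
  shows "finite (carrier (eis_ring Quot (PIdl\<^bsub>eis_ring\<^esub> \<alpha>)))"
    and "of_nat (card (carrier (eis_ring Quot (PIdl\<^bsub>eis_ring\<^esub> \<alpha>)))) = eis_norm \<alpha>"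
proof -
  interpret domain eis_ring by (rule eis_ring_domain)
  obtain a0 b0 :: int where \<alpha>0: "\<alpha> = of_int a0 + of_int b0 * \<omega>"
    using assms(1) by (auto simp: eis_ring_def)
  define g where "g = gcd a0 b0"
  have "a0 \<noteq> 0 \<or> b0 \<noteq> 0"
    using assms(2) \<alpha>0 by auto
  then have g: "g > 0"
    by (simp add: g_def)
  obtain a b where ab: "a0 = g * a" "b0 = g * b"
    by (metis g_def gcd_dvd1 gcd_dvd2 dvdE)
  obtain u v where "u * a0 + v * b0 = g"
    unfolding g_def by (metis bezout_int)
  then have "g * (a * u + b * v) = g * 1"
    by (simp add: ab algebra_simps)
  with g have bezout: "a * u + b * v = 1"
    by (simp only: mult_cancel_left) simp
  define n where "n = a\<^sup>2 - a * b + b\<^sup>2"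
  \<comment> \<open>Completing the square shows n > 0; if b = 0, Bezout forces a to be
    nonzero.\<close>
  have "4 * n = (2 * a - b)\<^sup>2 + 3 * b\<^sup>2"
    by (simp add: n_def power2_eq_square algebra_simps)
  moreover have "(2 * a - b)\<^sup>2 + 3 * b\<^sup>2 > 0"
  proof (cases "b = 0")
    case True
    with bezout show ?thesis by auto
  qed (simp add: add_nonneg_pos)
  ultimately have n: "n > 0" by linarith
  define e where "e = (\<lambda>(x, y). of_int x + of_int y * \<omega>)"
  define h where "h z = PIdl\<^bsub>eis_ring\<^esub> \<alpha> +>\<^bsub>eis_ring\<^esub> e z" for z
  define f where "f = (\<lambda>(x, y). ((a * y - b * x) mod (g * n), (u * x + v * y) mod g))"
  have e: "e z \<in> carrier eis_ring" for z
    by (cases z) (auto simp: e_def intro: eis_ring_memI)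
  have carrier: "carrier eis_ring = range e"
    by (auto simp: eis_ring_def e_def image_iff split: prod.splits)
  have quot: "carrier (eis_ring Quot (PIdl\<^bsub>eis_ring\<^esub> \<alpha>)) = range h"
    by (auto simp: FactRing_def A_RCOSETS_def' h_def carrier)
  \<comment> \<open>Equal cosets mean a difference in \<alpha>D; by uniqueness of coefficients this
    is the lattice condition, and the two divisibilities say that both residues agree.\<close>
  have "h z = h w \<longleftrightarrow> f z = f w" for z w
  proof -
    obtain x y x' y' where zw: "z = (x, y)" "w = (x', y')"
      by (cases z, cases w)
    have "h z = h w \<longleftrightarrow> (\<exists>r\<in>carrier eis_ring. e z - e w = \<alpha> * r)"
      unfolding h_def cgenideal_rcos_eq_iff[OF assms(1) e e] eis_a_minus[OF e e]
      by (simp add: eis_ring_def mult.commute)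
    also have "\<dots> \<longleftrightarrow> (\<exists>s t. x - x' = g * (a * s - b * t) \<and> y - y' = g * (a * t + b * s - b * t))"
    proof -
      have "e z - e w = \<alpha> * e (s, t) \<longleftrightarrow>
          x - x' = g * (a * s - b * t) \<and> y - y' = g * (a * t + b * s - b * t)" for s t
      proof -
        have 1: "e z - e w = of_int (x - x') + of_int (y - y') * \<omega>"
          by (simp add: e_def zw algebra_simps)
        have 2: "\<alpha> * e (s, t) = of_int (g * (a * s - b * t)) + of_int (g * (a * t + b * s - b * t)) * \<omega>"
          unfolding \<alpha>0 e_def prod.case eis_mult ab by (simp add: algebra_simps)
        show ?thesis
          unfolding 1 2 using eis_coeffs_unique by metis
      qed
      then show ?thesis
        by (auto simp: carrier)
    qed
    also have "\<dots> \<longleftrightarrow> g * n dvd a * (y - y') - b * (x - x') \<and> g dvd u * (x - x') + v * (y - y')"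
      unfolding n_def by (rule eis_lattice_iff[OF bezout])
    also have "\<dots> \<longleftrightarrow> f z = f w"
      by (simp add: f_def zw mod_eq_dvd_iff algebra_simps)
    finally show ?thesis .
  qed
  note fibres = card_range_eq[of h f, OF this]
  have range: "range f = {0..<g * n} \<times> {0..<g}"
    unfolding f_def using bezout g n by (intro range_mod_unimodular) auto
  show "finite (carrier (eis_ring Quot (PIdl\<^bsub>eis_ring\<^esub> \<alpha>)))"
    by (simp add: quot fibres range)
  \<comment> \<open>The grid has g n * g points, and g^2 n is the norm form at (a0, b0) = (g a, g
    b).\<close>
  have "int (card (range h)) = g * n * g"
    using g n by (simp add: fibres range card_cartesian_product)
  also have "\<dots> = a0\<^sup>2 - a0 * b0 + b0\<^sup>2"
    by (simp add: ab n_def power2_eq_square algebra_simps)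
  finally show "of_nat (card (carrier (eis_ring Quot (PIdl\<^bsub>eis_ring\<^esub> \<alpha>)))) = eis_norm \<alpha>"
    unfolding quot unfolding \<alpha>0 eis_norm_eq by (metis of_int_of_nat_eq)
qed

text \<open>Multiplication by a nonzero element is injective by cancellation, hence surjective by
  finiteness, so it attains \<open>\<one>\<close>.\<close>

lemma (in domain) finite_domain_field:
  assumes "finite (carrier R)"
  shows "field R"
proof (rule cring_fieldI2)
  fix a assume a: "a \<in> carrier R" "a \<noteq> \<zero>"
  have "inj_on ((\<otimes>) a) (carrier R)"
    using a by (auto simp: inj_on_def m_lcancel)
  then have "(\<otimes>) a ` carrier R = carrier R"
    using assms a by (intro endo_inj_surj) auto
  then show "\<exists>b\<in>carrier R. a \<otimes> b = \<one>"
    by (metis imageE one_closed)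
qed simp

theorem theorem3p5:
  fixes \<pi> :: complex
  assumes "\<pi> \<in> carrier eis_ring" and "ring_prime\<^bsub>eis_ring\<^esub> \<pi>"
  shows "field (eis_ring Quot (PIdl\<^bsub>eis_ring\<^esub> \<pi>))
    \<and> finite (carrier (eis_ring Quot (PIdl\<^bsub>eis_ring\<^esub> \<pi>)))
    \<and> of_nat (card (carrier (eis_ring Quot (PIdl\<^bsub>eis_ring\<^esub> \<pi>)))) = eis_norm \<pi>"
proof -
  interpret domain eis_ring by (rule eis_ring_domain)
  have nonzero: "\<pi> \<noteq> 0"
    using ring_primeE(1)[OF assms] by (simp add: eis_ring_def)
  note card = eis_quot_card[OF assms(1) this]
  \<comment> \<open>A nonzero prime element generates a prime ideal, so the quotient is a
    domain.\<close>
  interpret quot: domain "eis_ring Quot (PIdl\<^bsub>eis_ring\<^esub> \<pi>)"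
    using primeideal_iff_prime[of \<pi>] primeideal.quotient_is_domain assms nonzero
    by (simp add: eis_ring_def)
  show ?thesis
    using quot.finite_domain_field card by blast
qed

end
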